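(* Let $A$ be a complex Banach algebra and let $s,t$ be fixed nonzero complex numbers with $|s|<1$ and $|t|<1$. If mappings $g,h:A\to A$ satisfy $g(0)=h(0)=0$ and $$\|g(x+y)-g(x)-g(y)\|+\|h(x+y)+h(x-y)-2h(x)\|$$ $$\le\left\|s\left(2g\left(\frac{x+y}{2}\right)-g(x)-g(y)\right)\right\|+\left\|t\left(2h\left(\frac{x+y}{2}\right)+2h\left(\frac{x-y}{2}\right)-2h(x)\right)\right\|$$ for all $x,y\in A$, then the mappings $g,h:A\to A$ are additive.
   Context: A mapping $f:A\to A$ is additive if $f(x+y)=f(x)+f(y)$ for all $x,y\in A$. *)

theory Defs
  imports Complex_Main
begin

text \<open>
  The library has only real Banach algebras (sort \<open>{real_normed_algebra, banach}\<close>, without a unit).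
  A complex Banach algebra is such an algebra with a complex scalar multiplication that extends
  the real one, is compatible with the product on both sides, and satisfies the norm law for
  complex scalars. Neither a unit nor commutativity is assumed.
\<close>

class scaleC =
  fixes scaleC :: "complex \<Rightarrow> 'a \<Rightarrow> 'a" (infixr \<open>*\<^sub>C\<close> 75)

class complex_banach_algebra = real_normed_algebra + banach + scaleC +
  assumes scaleC_add_right: "a *\<^sub>C (x + y) = a *\<^sub>C x + a *\<^sub>C y"
    and scaleC_add_left: "(a + b) *\<^sub>C x = a *\<^sub>C x + b *\<^sub>C x"
    and scaleC_scaleC: "a *\<^sub>C b *\<^sub>C x = (a * b) *\<^sub>C x"
    and scaleC_one: "1 *\<^sub>C x = x"
    and scaleR_scaleC: "r *\<^sub>R x = complex_of_real r *\<^sub>C x"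
    and mult_scaleC_left: "a *\<^sub>C x * y = a *\<^sub>C (x * y)"
    and mult_scaleC_right: "x * a *\<^sub>C y = a *\<^sub>C (x * y)"
    and norm_scaleC: "norm (a *\<^sub>C x) = cmod a * norm x"

instantiation complex :: complex_banach_algebra
begin

definition scaleC_complex :: "complex \<Rightarrow> complex \<Rightarrow> complex"
  where "scaleC_complex a x = a * x"

instance
  by standard
    (simp_all add: scaleC_complex_def algebra_simps scaleR_conv_of_real norm_mult)

end

end

theory Submission
  imports Defs
begin

text \<open>
  Putting \<open>y = x\<close> makes the right-hand side vanish, so \<open>g\<close> and \<open>h\<close> commute with doubling and
  hence with halving. The right-hand side then becomes \<open>\<bar>s\<bar>\<close> and \<open>\<bar>t\<bar>\<close> times the two norms on the
  left, which must therefore be zero because \<open>\<bar>s\<bar>, \<bar>t\<bar> < 1\<close>.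
\<close>

theorem lemma2p1:
  fixes g h :: "'a::complex_banach_algebra \<Rightarrow> 'a"
    and s t :: complex
  assumes "s \<noteq> 0" and "t \<noteq> 0" and "cmod s < 1" and "cmod t < 1"
    and "g 0 = 0" and "h 0 = 0"
    and "\<And>x y. norm (g (x + y) - g x - g y) + norm (h (x + y) + h (x - y) - 2 *\<^sub>C h x)
        \<le> norm (s *\<^sub>C (2 *\<^sub>C g ((1/2) *\<^sub>C (x + y)) - g x - g y))
          + norm (t *\<^sub>C (2 *\<^sub>C h ((1/2) *\<^sub>C (x + y)) + 2 *\<^sub>C h ((1/2) *\<^sub>C (x - y)) - 2 *\<^sub>C h x))"
  shows "Modules.additive g \<and> Modules.additive h"
proof -
  note ineq = assms(7)
  \<comment> \<open>The scalars 2 and 1/2 are real, so rewriting them with \<open>scaleR\<close>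
    makes the simplification rules for real vector spaces available.\<close>
  have two: "2 *\<^sub>C x = 2 *\<^sub>R x" for x :: 'a
    by (simp add: scaleR_scaleC)
  have half: "(1/2) *\<^sub>C x = (1/2) *\<^sub>R x" for x :: 'a
    by (simp add: scaleR_scaleC)
  have double: "g (2 *\<^sub>R x) = 2 *\<^sub>R g x \<and> h (2 *\<^sub>R x) = 2 *\<^sub>R h x" for x
  proof -
    \<comment> \<open>For \<open>y = x\<close> the values of \<open>h\<close> at
      \<open>x - y\<close> are \<open>h 0 = 0\<close>, so they drop out on both sides.\<close>
    have "norm (g (2 *\<^sub>R x) - 2 *\<^sub>R g x) + norm (h (2 *\<^sub>R x) - 2 *\<^sub>R h x) \<le> 0"
      using ineq[of x x] assms(5,6)
      by (simp add: two half norm_scaleC scaleR_2[symmetric] diff_diff_eq)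
    then show ?thesis
      by (smt (verit) norm_ge_zero norm_eq_zero right_minus_eq)
  qed
  have halve: "2 *\<^sub>R g ((1/2) *\<^sub>R z) = g z" "2 *\<^sub>R h ((1/2) *\<^sub>R z) = h z" for z
    using double[of "(1/2) *\<^sub>R z"] by simp_all
  have zero: "g (x + y) - g x - g y = 0 \<and> h (x + y) + h (x - y) - 2 *\<^sub>R h x = 0" for x y
  proof -
    let ?G = "norm (g (x + y) - g x - g y)"
    let ?H = "norm (h (x + y) + h (x - y) - 2 *\<^sub>R h x)"
    have "?G + ?H \<le> cmod s * ?G + cmod t * ?H"
      using ineq[of x y] by (simp only: two half halve norm_scaleC)
    then have "(1 - cmod s) * ?G + (1 - cmod t) * ?H \<le> 0"
      by (simp add: algebra_simps)
    moreover have "0 \<le> (1 - cmod s) * ?G" "0 \<le> (1 - cmod t) * ?H"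
      using assms(3,4) by simp_all
    ultimately have "(1 - cmod s) * ?G = 0" "(1 - cmod t) * ?H = 0"
      by linarith+
    then show ?thesis
      using assms(3,4) by simp
  qed
  have "h (u + v) = h u + h v" for u v
  proof -
    \<comment> \<open>At this point \<open>h\<close> satisfies
      \<open>h (x + y) + h (x - y) = 2 *\<^sub>R h x\<close>. The midpoint and half-difference turn
      the left side into \<open>h u + h v\<close>, and halving turns the right side into
      \<open>h (u + v)\<close>.\<close>
    let ?x = "(1/2) *\<^sub>R (u + v)" and ?y = "(1/2) *\<^sub>R (u - v)"
    have "?x + ?y = u" "?x - ?y = v"
      by (simp_all add: scaleR_add_right[symmetric] scaleR_diff_right[symmetric]
          scaleR_2[symmetric])
    then show ?thesis
      using zero[of ?x ?y] halve(2)[of "u + v"] by simp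
  qed
  moreover have "g (u + v) = g u + g v" for u v
    using zero[of u v] by (simp add: algebra_simps)
  ultimately show ?thesis
    by (simp add: additive_def)
qed

end
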